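(* Consider the adjacency-list model augmented with $\texttt{ADJ}$ (and without $\texttt{JUMP}$ and $\texttt{IN-SORTED}$). For any $n$ and $m$ with $n\le m\le n^2$, there exists a directed graph $G=(V,E)$ with $\Theta(n)$ nodes and $\Theta(m)$ edges such that for any algorithm solving the single-node problem, the expected running time on $G$, averaged over all targets $t\in V$, is $\Omega(m)$. In particular, this bound holds for a worst-case target $t\in V$.
   Context: Fix a constant $\alpha\in(0,1)$. For a directed graph $G=(V,E)$ with $n=|V|$, an $\alpha$-discounted random walk from $s$: at each step, with probability $\alpha$ it terminates at the current node, otherwise it moves to a uniformly random out-neighbor of the current node. $\pi(s,t)$ is the probability that such a walk from $s$ terminates at $t$, and $\pi(t)=\frac1n\sum_{s\in V}\pi(s,t)$. Adjacency-list model: an algorithm accesses $G$ only through constant-time queries $\texttt{DEG-IN}(u)$, $\texttt{DEG-OUT}(u)$ (in-/out-degree of $u$), $\texttt{IN}(u,i)$, $\texttt{OUT}(u,i)$ ($i$-th in-/out-neighbor of $u$); additionally $\texttt{ADJ}(u,v)$ returns whether $(u,v)\in E$. Single-node problem: given $G$ (via queries) and a target $t\in V$, output $\hat\pi(t)$ with $\Pr\{|\hat\pi(t)-\pi(t)|\ge\varepsilon\pi(t)\}\le p_f$, where $\varepsilon,p_f$ are fixed small constants; an algorithm solves the problem if this holds for every input. *)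

theory Defs
  imports "HOL-Probability.Probability" "Graph_Theory.Pair_Digraph"
begin

text \<open>
  Inputs are finite directed graphs without parallel edges (self-loops are allowed, so there are
  at most $n^2$ edges). Every node has an out-neighbour, so that a walk can always move on.
\<close>

definition pagerank_graph :: "nat pair_pre_digraph \<Rightarrow> bool" where
  "pagerank_graph G \<longleftrightarrow> pair_fin_digraph G \<and> (\<forall>u\<in>pverts G. parcs G `` {u} \<noteq> {})"


section \<open>PageRank\<close>

datatype walk_state = At nat | Terminated nat

fun walk_step :: "real \<Rightarrow> nat pair_pre_digraph \<Rightarrow> walk_state \<Rightarrow> walk_state pmf" where
  "walk_step \<alpha> G (Terminated v) = return_pmf (Terminated v)"
| "walk_step \<alpha> G (At v) =
     bernoulli_pmf \<alpha> \<bind>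
       (\<lambda>stop. if stop then return_pmf (Terminated v) else map_pmf At (pmf_of_set (parcs G `` {v})))"

primrec walk :: "real \<Rightarrow> nat pair_pre_digraph \<Rightarrow> nat \<Rightarrow> nat \<Rightarrow> walk_state pmf" where
  "walk \<alpha> G s 0 = return_pmf (At s)"
| "walk \<alpha> G s (Suc k) = walk \<alpha> G s k \<bind> walk_step \<alpha> G"

text \<open>
  The events ``terminated at \<open>t\<close> within \<open>k\<close> steps'' increase with \<open>k\<close>; the supremum is the
  probability of their union.
\<close>

definition ppr :: "real \<Rightarrow> nat pair_pre_digraph \<Rightarrow> nat \<Rightarrow> nat \<Rightarrow> real" where
  "ppr \<alpha> G s t = (SUP k. pmf (walk \<alpha> G s k) (Terminated t))"

definition pagerank :: "real \<Rightarrow> nat pair_pre_digraph \<Rightarrow> nat \<Rightarrow> real" where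
  "pagerank \<alpha> G t = (\<Sum>s\<in>pverts G. ppr \<alpha> G s t) / real (card (pverts G))"


section \<open>Adjacency-list model with ADJ\<close>

record adj_lists =
  graph_of :: "nat pair_pre_digraph"
  out_list :: "nat \<Rightarrow> nat list"
  in_list :: "nat \<Rightarrow> nat list"

definition valid_input :: "adj_lists \<Rightarrow> bool" where
  "valid_input X \<longleftrightarrow> pagerank_graph (graph_of X) \<and>
     (\<forall>u\<in>pverts (graph_of X).
        distinct (out_list X u) \<and> set (out_list X u) = {v. (u, v) \<in> parcs (graph_of X)} \<and>
        distinct (in_list X u) \<and> set (in_list X u) = {v. (v, u) \<in> parcs (graph_of X)})"

datatype query = DEG_IN nat | DEG_OUT nat | IN nat nat | OUT nat nat | ADJ nat nat

datatype answer = Degree nat | Neighbor nat | Adjacent bool | Undefined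

fun query_nodes :: "query \<Rightarrow> nat set" where
  "query_nodes (DEG_IN u) = {u}"
| "query_nodes (DEG_OUT u) = {u}"
| "query_nodes (IN u i) = {u}"
| "query_nodes (OUT u i) = {u}"
| "query_nodes (ADJ u v) = {u, v}"

text \<open>Neighbours are numbered from 0.\<close>

fun oracle_answer :: "adj_lists \<Rightarrow> query \<Rightarrow> answer" where
  "oracle_answer X (DEG_IN u) = Degree (length (in_list X u))"
| "oracle_answer X (DEG_OUT u) = Degree (length (out_list X u))"
| "oracle_answer X (IN u i) =
     (if i < length (in_list X u) then Neighbor (in_list X u ! i) else Undefined)"
| "oracle_answer X (OUT u i) =
     (if i < length (out_list X u) then Neighbor (out_list X u ! i) else Undefined)"
| "oracle_answer X (ADJ u v) = Adjacent ((u, v) \<in> parcs (graph_of X))"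

text \<open>
  A transcript records everything that has happened so far: the queries with their answers, and
  the internal steps, each with a value the algorithm has stored (such as random bits it has drawn).
  Because there is no JUMP, an algorithm can only address nodes it has discovered, i.e. the target
  and the nodes returned by earlier IN and OUT queries; any other query yields no information.
\<close>

datatype event = Asked query answer | Computed nat

definition discovered :: "nat \<Rightarrow> event list \<Rightarrow> nat set" where
  "discovered t h = insert t {v. \<exists>q. Asked q (Neighbor v) \<in> set h}"

definition reply :: "adj_lists \<Rightarrow> nat \<Rightarrow> event list \<Rightarrow> query \<Rightarrow> answer" where
  "reply X t h q = (if query_nodes q \<subseteq> discovered t h then oracle_answer X q else Undefined)"

text \<open>
  A randomized algorithm is given the number of nodes and the target. It chooses its next action at
  random, with a distribution that may depend in any way on the transcript. Queries and internal
  steps take one unit of time each.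
\<close>

datatype action = Query query | Compute nat | Output real

type_synonym algorithm = "nat \<Rightarrow> nat \<Rightarrow> event list \<Rightarrow> action pmf"

datatype run_state = Running "event list" | Halted "event list" real

fun transcript :: "run_state \<Rightarrow> event list" where
  "transcript (Running h) = h"
| "transcript (Halted h x) = h"

fun act :: "adj_lists \<Rightarrow> nat \<Rightarrow> event list \<Rightarrow> action \<Rightarrow> run_state" where
  "act X t h (Query q) = Running (h @ [Asked q (reply X t h q)])"
| "act X t h (Compute r) = Running (h @ [Computed r])"
| "act X t h (Output x) = Halted h x"

fun run_step :: "algorithm \<Rightarrow> adj_lists \<Rightarrow> nat \<Rightarrow> run_state \<Rightarrow> run_state pmf" where
  "run_step A X t (Halted h x) = return_pmf (Halted h x)"
| "run_step A X t (Running h) = map_pmf (act X t h) (A (card (pverts (graph_of X))) t h)"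

primrec run :: "algorithm \<Rightarrow> adj_lists \<Rightarrow> nat \<Rightarrow> nat \<Rightarrow> run_state pmf" where
  "run A X t 0 = return_pmf (Running [])"
| "run A X t (Suc k) = run A X t k \<bind> run_step A X t"

text \<open>
  The transcript length is the time elapsed so far. Its expectation after \<open>k\<close> steps increases with
  \<open>k\<close>, and the supremum is the expected running time (infinite if the algorithm fails to halt with
  positive probability).
\<close>

definition expected_time :: "algorithm \<Rightarrow> adj_lists \<Rightarrow> nat \<Rightarrow> ennreal" where
  "expected_time A X t =
     (SUP k. \<integral>\<^sup>+ s. of_nat (length (transcript s)) \<partial>measure_pmf (run A X t k))"

fun accurate :: "real \<Rightarrow> real \<Rightarrow> run_state \<Rightarrow> bool" where
  "accurate \<epsilon> p (Halted h x) \<longleftrightarrow> \<not> \<bar>x - p\<bar> \<ge> \<epsilon> * p"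
| "accurate \<epsilon> p (Running h) \<longleftrightarrow> False"

text \<open>Never halting counts as a failure. The events decrease with \<open>k\<close>.\<close>

definition failure_prob :: "real \<Rightarrow> real \<Rightarrow> algorithm \<Rightarrow> adj_lists \<Rightarrow> nat \<Rightarrow> real" where
  "failure_prob \<alpha> \<epsilon> A X t =
     (INF k. measure_pmf.prob (run A X t k) {s. \<not> accurate \<epsilon> (pagerank \<alpha> (graph_of X) t) s})"

definition solves_single_node :: "real \<Rightarrow> real \<Rightarrow> real \<Rightarrow> algorithm \<Rightarrow> bool" where
  "solves_single_node \<alpha> \<epsilon> p\<^sub>f A \<longleftrightarrow>
     (\<forall>X t. valid_input X \<longrightarrow> t \<in> pverts (graph_of X) \<longrightarrow> failure_prob \<alpha> \<epsilon> A X t \<le> p\<^sub>f)"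

end

theory Submission
  imports Defs
begin

text \<open>
  The graph consists of complete bipartite layers \<open>U \<rightarrow> W \<rightarrow> T\<close> with \<open>|U| = |T| = n\<close> and
  \<open>|W| = m div n\<close>, self-loops on \<open>T\<close>, and an undiscoverable reservoir of \<open>\<Theta>(n)\<close> nodes
  \<open>S \<union> {x}\<close> carrying only self-loops. For each of the \<open>\<Theta>(m)\<close> edges \<open>(u, w)\<close> from \<open>U\<close> to \<open>W\<close>
  there is a planted variant in which all of \<open>S\<close> points to \<open>x\<close>, and \<open>u \<rightarrow> w\<close> is replaced by
  \<open>u \<rightarrow> x\<close> and \<open>x \<rightarrow> w\<close>. The reservoir then feeds every target in \<open>T\<close> through \<open>w\<close>, which raises its
  PageRank by a factor of at least \<open>(1 + \<epsilon>) / (1 - \<epsilon>)\<close>, so a correct algorithm has to tell the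
  variants from the original. All degrees in the discoverable part are preserved, and only queries
  that probe the very edge \<open>(u, w)\<close> are answered differently. As a query probes at most one edge
  and every edge must be probed with probability at least a constant, the expected number of
  queries is \<open>\<Omega>(m)\<close>.
\<close>

section \<open>Bounds on PageRank\<close>

text \<open>Other intermediate values only add mass. Iterated along one fixed path of the graph,
  this bounds termination probabilities from below.\<close>

lemma pmf_bind_ge: "pmf M x * pmf (f x) y \<le> pmf (M \<bind> f) y"
proof -
  have "ennreal (pmf M x * pmf (f x) y) = (\<integral>\<^sup>+ z. ennreal (pmf (f x) y) * indicator {x} z \<partial>measure_pmf M)"
    by (simp add: nn_integral_cmult_indicator emeasure_pmf_single ennreal_mult mult.commute)
  also have "\<dots> \<le> (\<integral>\<^sup>+ z. ennreal (pmf (f z) y) \<partial>measure_pmf M)"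
    by (intro nn_integral_mono) (auto simp: indicator_def)
  also have "\<dots> = ennreal (pmf (M \<bind> f) y)"
    by (simp add: ennreal_pmf_bind)
  finally show ?thesis
    by simp
qed

lemma pmf_le_ppr: "pmf (walk \<alpha> G s k) (Terminated t) \<le> ppr \<alpha> G s t"
  unfolding ppr_def by (rule cSUP_upper) (auto intro!: bdd_aboveI[of _ 1] simp: pmf_le_1)

lemma ppr_nonneg: "0 \<le> ppr \<alpha> G s t"
  by (rule order_trans[OF pmf_nonneg pmf_le_ppr])

lemma pmf_walk_step_At:
  assumes "0 \<le> \<alpha>" "\<alpha> \<le> 1" "finite (parcs G `` {v})" "(v, z) \<in> parcs G"
  shows "(1 - \<alpha>) / real (card (parcs G `` {v})) \<le> pmf (walk_step \<alpha> G (At v)) (At z)"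
proof -
  let ?f = "\<lambda>stop. if stop then return_pmf (Terminated v) else map_pmf At (pmf_of_set (parcs G `` {v}))"
  have "z \<in> parcs G `` {v}"
    using assms by auto
  then have "pmf (?f False) (At z) = 1 / real (card (parcs G `` {v}))"
    using assms(3) by (subst if_False, subst pmf_map_inj', simp add: inj_def, subst pmf_of_set) auto
  moreover have "pmf (bernoulli_pmf \<alpha>) False * pmf (?f False) (At z) \<le> pmf (bernoulli_pmf \<alpha> \<bind> ?f) (At z)"
    by (rule pmf_bind_ge)
  ultimately show ?thesis
    using assms by simp
qed

lemma pmf_walk_step_Terminated:
  assumes "0 \<le> \<alpha>" "\<alpha> \<le> 1"
  shows "\<alpha> \<le> pmf (walk_step \<alpha> G (At v)) (Terminated v)"
proof -
  let ?f = "\<lambda>stop. if stop then return_pmf (Terminated v) else map_pmf At (pmf_of_set (parcs G `` {v}))"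
  have "pmf (bernoulli_pmf \<alpha>) True * pmf (?f True) (Terminated v)
      \<le> pmf (bernoulli_pmf \<alpha> \<bind> ?f) (Terminated v)"
    by (rule pmf_bind_ge)
  then show ?thesis
    using assms by simp
qed

lemma pmf_walk_Suc_ge:
  assumes "a \<le> pmf (walk \<alpha> G s k) y" "b \<le> pmf (walk_step \<alpha> G y) z" "0 \<le> a" "0 \<le> b"
  shows "a * b \<le> pmf (walk \<alpha> G s (Suc k)) z"
proof -
  have "a * b \<le> pmf (walk \<alpha> G s k) y * pmf (walk_step \<alpha> G y) z"
    using assms by (intro mult_mono) auto
  also have "\<dots> \<le> pmf (walk \<alpha> G s (Suc k)) z"
    by (simp add: pmf_bind_ge)
  finally show ?thesis .
qed

text \<open>Superharmonicity will be assumed at nodes of the graph only, so the walk must be known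
  never to leave them.\<close>

lemma set_pmf_walk:
  assumes G: "pagerank_graph G" and s: "s \<in> pverts G"
  shows "set_pmf (walk \<alpha> G s k) \<subseteq> At ` pverts G \<union> range Terminated"
proof (induction k)
  case (Suc k)
  have step: "set_pmf (walk_step \<alpha> G y) \<subseteq> At ` pverts G \<union> range Terminated"
    if y: "y \<in> At ` pverts G \<union> range Terminated" for y
  proof (cases y)
    case (At v)
    interpret pair_fin_digraph G
      using G by (simp add: pagerank_graph_def)
    have v: "v \<in> pverts G"
      using y At by auto
    have "parcs G `` {v} \<noteq> {}"
      using G v by (auto simp: pagerank_graph_def)
    moreover have "finite (parcs G `` {v})"
      using pair_finite_arcs by (rule finite_Image)
    moreover have "parcs G `` {v} \<subseteq> pverts G"
      using in_arcsD2 by auto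
    ultimately have "set_pmf (pmf_of_set (parcs G `` {v})) \<subseteq> pverts G"
      by simp
    then show ?thesis
      unfolding At by (fastforce split: if_splits)
  qed auto
  show ?case
    unfolding walk.simps set_bind_pmf using Suc by (intro UN_least step) (rule subsetD)
qed (use s in auto)

text \<open>Extended by 1 to \<open>Terminated t\<close> and by 0 to the other terminated states,
  \<open>f\<close> becomes a supermartingale along the walk. It dominates the indicator of
  \<open>Terminated t\<close>, so the probability of that state never exceeds the initial value
  \<open>f s\<close>. Upper bounds on \<open>ppr\<close> thus need only a good guess for
  \<open>f\<close>.\<close>

lemma ppr_le_superharmonic:
  assumes G: "pagerank_graph G" and s: "s \<in> pverts G" and \<alpha>: "0 \<le> \<alpha>" "\<alpha> \<le> 1"
    and f: "\<And>v. 0 \<le> f v"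
    and super: "\<And>v. v \<in> pverts G \<Longrightarrow>
      \<alpha> * of_bool (v = t) + (1 - \<alpha>) * ((\<Sum>z\<in>parcs G `` {v}. f z) / real (card (parcs G `` {v}))) \<le> f v"
  shows "ppr \<alpha> G s t \<le> f s"
  unfolding ppr_def
proof (rule cSUP_least)
  fix k
  interpret pair_fin_digraph G
    using G by (simp add: pagerank_graph_def)
  define F where "F y = (case y of At v \<Rightarrow> ennreal (f v) | Terminated v \<Rightarrow> ennreal (of_bool (v = t)))" for y
  have step: "(\<integral>\<^sup>+ z. F z \<partial>measure_pmf (walk_step \<alpha> G y)) \<le> F y"
    if y: "y \<in> At ` pverts G \<union> range Terminated" for y
  proof (cases y)
    case (At v)
    have v: "v \<in> pverts G"
      using y At by auto
    have ne: "parcs G `` {v} \<noteq> {}"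
      using G v by (auto simp: pagerank_graph_def)
    have fin: "finite (parcs G `` {v})"
      using pair_finite_arcs by (rule finite_Image)
    have "(\<integral>\<^sup>+ z. F z \<partial>measure_pmf (walk_step \<alpha> G y)) =
        ennreal (of_bool (v = t)) * ennreal \<alpha> +
        (\<Sum>z\<in>parcs G `` {v}. ennreal (f z)) / of_nat (card (parcs G `` {v})) * ennreal (1 - \<alpha>)"
      unfolding At using \<alpha> ne fin
      by (simp add: nn_integral_pmf_of_set F_def)
    also have "\<dots> = ennreal (\<alpha> * of_bool (v = t) +
        (1 - \<alpha>) * ((\<Sum>z\<in>parcs G `` {v}. f z) / real (card (parcs G `` {v}))))"
      using \<alpha> ne fin f
      by (simp add: ennreal_plus ennreal_mult sum_nonneg divide_ennreal[symmetric] card_gt_0_iff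
          ennreal_of_nat_eq_real_of_nat ennreal_times_divide mult.commute)
    also have "\<dots> \<le> F y"
      using super[OF v] by (simp add: At F_def ennreal_leI)
    finally show ?thesis .
  qed (simp add: F_def)
  have "(\<integral>\<^sup>+ y. F y \<partial>measure_pmf (walk \<alpha> G s k)) \<le> ennreal (f s)" for k
  proof (induction k)
    case (Suc k)
    have "(\<integral>\<^sup>+ y. F y \<partial>measure_pmf (walk \<alpha> G s (Suc k))) =
        (\<integral>\<^sup>+ y. (\<integral>\<^sup>+ z. F z \<partial>measure_pmf (walk_step \<alpha> G y)) \<partial>measure_pmf (walk \<alpha> G s k))"
      by simp
    also have "\<dots> \<le> (\<integral>\<^sup>+ y. F y \<partial>measure_pmf (walk \<alpha> G s k))"
      using set_pmf_walk[OF G s] by (intro nn_integral_mono_AE, unfold AE_measure_pmf_iff) (blast intro: step)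
    finally show ?case
      using Suc by simp
  qed (simp add: F_def)
  moreover have "ennreal (pmf (walk \<alpha> G s k) (Terminated t)) =
      (\<integral>\<^sup>+ y. indicator {Terminated t} y \<partial>measure_pmf (walk \<alpha> G s k))"
    by (simp add: emeasure_pmf_single)
  moreover have "\<dots> \<le> (\<integral>\<^sup>+ y. F y \<partial>measure_pmf (walk \<alpha> G s k))"
    by (intro nn_integral_mono) (auto simp: F_def indicator_def)
  ultimately have "ennreal (pmf (walk \<alpha> G s k) (Terminated t)) \<le> ennreal (f s)"
    by (metis order_trans)
  then show "pmf (walk \<alpha> G s k) (Terminated t) \<le> f s"
    using f by simp
qed simp


section \<open>Runs on inputs that differ on few queries\<close>

text \<open>
  \<open>V\<close> is the set of nodes an algorithm can legitimately know, \<open>B\<close> the set of queries on which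
  two inputs may disagree.
\<close>

definition clean :: "nat set \<Rightarrow> query set \<Rightarrow> event list \<Rightarrow> bool" where
  "clean V B h \<longleftrightarrow> (\<forall>q a. Asked q a \<in> set h \<longrightarrow> q \<notin> B \<and> (\<forall>v. a = Neighbor v \<longrightarrow> v \<in> V))"

lemma clean_snoc_Asked:
  "clean V B (h @ [Asked q a]) \<longleftrightarrow> clean V B h \<and> q \<notin> B \<and> (\<forall>v. a = Neighbor v \<longrightarrow> v \<in> V)"
  by (auto simp: clean_def)

lemma clean_snoc_Computed: "clean V B (h @ [Computed r]) \<longleftrightarrow> clean V B h"
  by (auto simp: clean_def)

text \<open>Two runs may diverge arbitrarily once a query in \<open>B\<close> has been asked.
  Merging all unclean states into \<open>None\<close> makes their laws exactly equal.\<close>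

definition censor :: "nat set \<Rightarrow> query set \<Rightarrow> run_state \<Rightarrow> run_state option" where
  "censor V B s = (if clean V B (transcript s) then Some s else None)"

lemma clean_discovered: "t \<in> V \<Longrightarrow> clean V B h \<Longrightarrow> discovered t h \<subseteq> V"
  by (auto simp: clean_def discovered_def)

text \<open>Transcripts only grow, so a recorded violation is never undone and \<open>None\<close>
  is absorbing.\<close>

lemma censor_run_step_unclean:
  assumes "\<not> clean V B (transcript s)"
  shows "map_pmf (censor V B) (run_step A X t s) = return_pmf None"
proof (cases s)
  case (Running h)
  have "censor V B (act X t h a) = None" for a
    using assms Running by (cases a) (auto simp: censor_def clean_snoc_Asked clean_snoc_Computed)
  then show ?thesis
    using Running by (simp add: pmf.map_comp comp_def map_pmf_const)
qed (use assms in \<open>auto simp: censor_def\<close>)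

text \<open>A clean transcript has revealed only nodes of \<open>V\<close>. Hence a query outside
  \<open>B\<close> is either answered alike by both inputs or refused by both, while a query in
  \<open>B\<close> leads to \<open>None\<close> whatever the answers are.\<close>

lemma censor_run_step_cong:
  assumes t: "t \<in> V"
    and card: "card (pverts (graph_of X)) = card (pverts (graph_of Y))"
    and agree: "\<And>q. query_nodes q \<subseteq> V \<Longrightarrow> q \<notin> B \<Longrightarrow> oracle_answer X q = oracle_answer Y q"
    and clean: "clean V B (transcript s)"
  shows "map_pmf (censor V B) (run_step A X t s) = map_pmf (censor V B) (run_step A Y t s)"
proof (cases s)
  case (Running h)
  have "censor V B (act X t h a) = censor V B (act Y t h a)" for a
  proof (cases a)
    case (Query q)
    have "discovered t h \<subseteq> V"
      using clean_discovered t clean Running by simp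
    then have "q \<notin> B \<Longrightarrow> reply X t h q = reply Y t h q"
      using agree by (auto simp: reply_def)
    then show ?thesis
      using Query by (auto simp: censor_def clean_snoc_Asked)
  qed auto
  then show ?thesis
    using Running card by (simp add: pmf.map_comp comp_def)
qed auto

lemma censor_run_cong:
  assumes t: "t \<in> V"
    and card: "card (pverts (graph_of X)) = card (pverts (graph_of Y))"
    and agree: "\<And>q. query_nodes q \<subseteq> V \<Longrightarrow> q \<notin> B \<Longrightarrow> oracle_answer X q = oracle_answer Y q"
  shows "map_pmf (censor V B) (run A X t k) = map_pmf (censor V B) (run A Y t k)"
proof (induction k)
  case (Suc k)
  \<comment> \<open>The censored process is itself a Markov chain, with kernel \<open>g Z\<close>,
    and the two kernels agree on every censored state in the support.\<close>
  define g where "g Z o' = (case o' of None \<Rightarrow> return_pmf None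
    | Some s \<Rightarrow> map_pmf (censor V B) (run_step A Z t s))" for Z o'
  have g: "map_pmf (censor V B) (run A Z t (Suc k)) = map_pmf (censor V B) (run A Z t k) \<bind> g Z" for Z
  proof -
    have "map_pmf (censor V B) (run_step A Z t s) = g Z (censor V B s)" for s
      using censor_run_step_unclean by (auto simp: g_def censor_def)
    then show ?thesis
      by (simp add: map_bind_pmf bind_map_pmf)
  qed
  have "map_pmf (censor V B) (run A Y t k) \<bind> g X = map_pmf (censor V B) (run A Y t k) \<bind> g Y"
  proof (rule bind_pmf_cong[OF refl])
    fix o' assume "o' \<in> set_pmf (map_pmf (censor V B) (run A Y t k))"
    then show "g X o' = g Y o'"
      using censor_run_step_cong[OF t card agree, of B] by (auto simp: g_def censor_def)
  qed
  then show ?case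
    unfolding g Suc .
qed simp

text \<open>Both events are preimages under \<open>censor V B\<close>, whose image laws
  coincide.\<close>

lemma prob_run_cong:
  assumes "t \<in> V"
    and "card (pverts (graph_of X)) = card (pverts (graph_of Y))"
    and "\<And>q. query_nodes q \<subseteq> V \<Longrightarrow> q \<notin> B \<Longrightarrow> oracle_answer X q = oracle_answer Y q"
  shows "measure_pmf.prob (run A X t k) {s. P s \<and> clean V B (transcript s)} =
      measure_pmf.prob (run A Y t k) {s. P s \<and> clean V B (transcript s)}" (is ?P)
    and "measure_pmf.prob (run A X t k) {s. \<not> clean V B (transcript s)} =
      measure_pmf.prob (run A Y t k) {s. \<not> clean V B (transcript s)}" (is ?C)
proof -
  have *: "measure_pmf.prob (run A X t k) (censor V B -` E) = measure_pmf.prob (run A Y t k) (censor V B -` E)" for E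
    using censor_run_cong[OF assms, where A = A and k = k] by (metis measure_map_pmf)
  have "censor V B -` (Some ` Collect P) = {s. P s \<and> clean V B (transcript s)}"
    by (auto simp: censor_def split: if_splits)
  then show ?P
    using *[of "Some ` Collect P"] by simp
  have "censor V B -` {None} = {s. \<not> clean V B (transcript s)}"
    by (auto simp: censor_def split: if_splits)
  then show ?C
    using *[of "{None}"] by simp
qed

text \<open>With \<open>B\<close> empty, \<open>clean\<close> only says that all returned neighbours
  lie in \<open>V\<close>. This excludes one source of uncleanness, so that later an unclean run
  must really have asked a query in \<open>B\<close>.\<close>

lemma neighbors_in_run:
  assumes t: "t \<in> V"
    and closed: "\<And>q v. query_nodes q \<subseteq> V \<Longrightarrow> oracle_answer X q = Neighbor v \<Longrightarrow> v \<in> V"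
    and "s \<in> set_pmf (run A X t k)"
  shows "clean V {} (transcript s)"
  using assms(3)
proof (induction k arbitrary: s)
  case (Suc k)
  then obtain r where r: "r \<in> set_pmf (run A X t k)" "s \<in> set_pmf (run_step A X t r)"
    by auto
  have c: "clean V {} (transcript r)"
    using Suc r by auto
  show ?case
  proof (cases r)
    case (Running h)
    then obtain a where s: "s = act X t h a"
      using r by auto
    have "discovered t h \<subseteq> V"
      using clean_discovered[OF t c] Running by simp
    then have "reply X t h q = Neighbor v \<Longrightarrow> v \<in> V" for q v
      using closed[of q v] by (auto simp: reply_def split: if_splits)
    then show ?thesis
      using c Running s by (cases a) (auto simp: clean_snoc_Asked clean_snoc_Computed)
  qed (use r c in auto)
qed (simp add: clean_def)

section \<open>Telling two inputs apart, and counting probed edges\<close>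

text \<open>An accurate state is halted, hence absorbing, so mass can only leave the inaccurate
  states.\<close>

lemma prob_inaccurate_Suc_le:
  "measure_pmf.prob (run A X t (Suc k)) {s. \<not> accurate \<epsilon> p s}
    \<le> measure_pmf.prob (run A X t k) {s. \<not> accurate \<epsilon> p s}"
proof -
  have 1: "emeasure (measure_pmf (run_step A X t s)) {s. \<not> accurate \<epsilon> p s} \<le> indicator {s. \<not> accurate \<epsilon> p s} s" for s
  proof (cases "accurate \<epsilon> p s")
    case True
    then show ?thesis
      by (cases s) auto
  qed (simp add: measure_pmf.emeasure_le_1)
  have "emeasure (measure_pmf (run A X t (Suc k))) {s. \<not> accurate \<epsilon> p s} =
      (\<integral>\<^sup>+ s. emeasure (measure_pmf (run_step A X t s)) {s. \<not> accurate \<epsilon> p s} \<partial>measure_pmf (run A X t k))"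
    by simp
  also have "\<dots> \<le> (\<integral>\<^sup>+ s. indicator {s. \<not> accurate \<epsilon> p s} s \<partial>measure_pmf (run A X t k))"
    by (intro nn_integral_mono 1)
  finally show ?thesis
    by (simp add: measure_pmf.emeasure_eq_measure)
qed

text \<open>The failure probability is an infimum that need not be attained, hence the slack
  \<open>\<eta>\<close>. By monotonicity the bound persists at all later times, so that finitely
  many inputs can share one time \<open>k\<close>.\<close>

lemma eventually_prob_inaccurate:
  assumes "failure_prob \<alpha> \<epsilon> A X t \<le> q" "0 < \<eta>"
  shows "\<forall>\<^sub>F k in sequentially.
    measure_pmf.prob (run A X t k) {s. \<not> accurate \<epsilon> (pagerank \<alpha> (graph_of X) t) s} < q + \<eta>"
proof -
  let ?f = "\<lambda>k. measure_pmf.prob (run A X t k) {s. \<not> accurate \<epsilon> (pagerank \<alpha> (graph_of X) t) s}"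
  have "(INF k. ?f k) < q + \<eta>"
    using assms by (simp add: failure_prob_def)
  moreover have "bdd_below (range ?f)"
    by (rule bdd_belowI[of _ 0]) auto
  ultimately obtain k where k: "?f k < q + \<eta>"
    by (auto simp: cINF_less_iff)
  have "decseq ?f"
    by (rule decseq_SucI) (rule prob_inaccurate_Suc_le)
  then have "?f j < q + \<eta>" if "k \<le> j" for j
    using k that decseqD[of ?f k j] by linarith
  then show ?thesis
    by (auto simp: eventually_sequentially)
qed

text \<open>A run on \<open>Y\<close> is mostly accurate for \<open>Y\<close>. The clean runs among
  these are equally likely on \<open>X\<close>, but there they are failures, since by
  \<open>gap\<close> no output suits both inputs. The remaining mass must be unclean, and
  uncleanness has the same probability on both inputs.\<close>

lemma eventually_prob_distinguish:
  assumes "t \<in> V"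
    and "card (pverts (graph_of X)) = card (pverts (graph_of Y))"
    and "\<And>q. query_nodes q \<subseteq> V \<Longrightarrow> q \<notin> B \<Longrightarrow> oracle_answer X q = oracle_answer Y q"
    and fail: "failure_prob \<alpha> \<epsilon> A X t \<le> p\<^sub>f" "failure_prob \<alpha> \<epsilon> A Y t \<le> p\<^sub>f" and pf: "p\<^sub>f < 1 / 2"
    and gap: "(1 + \<epsilon>) * pagerank \<alpha> (graph_of X) t \<le> (1 - \<epsilon>) * pagerank \<alpha> (graph_of Y) t"
  shows "\<forall>\<^sub>F k in sequentially.
    (1 - 2 * p\<^sub>f) / 2 \<le> measure_pmf.prob (run A X t k) {s. \<not> clean V B (transcript s)}"
proof -
  \<comment> \<open>Chosen so that 1 - 2 * (\<open>p\<^sub>f\<close> + \<open>\<eta>\<close>) equals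
    the claimed bound.\<close>
  define \<eta> where "\<eta> = (1 - 2 * p\<^sub>f) / 4"
  have "0 < \<eta>"
    using pf by (simp add: \<eta>_def)
  then have ev: "\<forall>\<^sub>F k in sequentially.
      measure_pmf.prob (run A X t k) {s. \<not> accurate \<epsilon> (pagerank \<alpha> (graph_of X) t) s} < p\<^sub>f + \<eta> \<and>
      measure_pmf.prob (run A Y t k) {s. \<not> accurate \<epsilon> (pagerank \<alpha> (graph_of Y) t) s} < p\<^sub>f + \<eta>"
    using eventually_prob_inaccurate fail by (intro eventually_conj)
  show ?thesis
    using ev
  proof eventually_elim
    case (elim k)
    let ?aX = "accurate \<epsilon> (pagerank \<alpha> (graph_of X) t)" and ?aY = "accurate \<epsilon> (pagerank \<alpha> (graph_of Y) t)"
    let ?PX = "measure_pmf.prob (run A X t k)" and ?PY = "measure_pmf.prob (run A Y t k)"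
    \<comment> \<open>Accuracy is a strict inequality, so the two intervals of accurate outputs stay
      disjoint even if \<open>gap\<close> holds with equality.\<close>
    have disj: "\<not> (?aX s \<and> ?aY s)" for s
      using gap by (cases s) (auto simp: abs_if algebra_simps split: if_splits)
    have "?PX {s. ?aX s} = 1 - ?PX {s. \<not> ?aX s}" "?PY {s. ?aY s} = 1 - ?PY {s. \<not> ?aY s}"
      using measure_pmf.prob_neg[of "run A X t k" "\<lambda>s. \<not> ?aX s"]
        measure_pmf.prob_neg[of "run A Y t k" "\<lambda>s. \<not> ?aY s"]
      by simp_all
    then have acc: "?PX {s. ?aX s} > 1 - p\<^sub>f - \<eta>" "?PY {s. ?aY s} > 1 - p\<^sub>f - \<eta>"
      using elim by auto
    have "?PY {s. ?aY s} \<le> ?PY ({s. ?aY s \<and> clean V B (transcript s)} \<union> {s. \<not> clean V B (transcript s)})"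
      by (intro measure_pmf.finite_measure_mono) auto
    also have "\<dots> \<le> ?PY {s. ?aY s \<and> clean V B (transcript s)} + ?PY {s. \<not> clean V B (transcript s)}"
      by (rule measure_Un_le) auto
    also have "\<dots> = ?PX {s. ?aY s \<and> clean V B (transcript s)} + ?PX {s. \<not> clean V B (transcript s)}"
      using prob_run_cong[of t V X Y B A k, OF assms(1-3)] by simp
    also have "?PX {s. ?aY s \<and> clean V B (transcript s)} \<le> ?PX {s. \<not> ?aX s}"
      using disj by (intro measure_pmf.finite_measure_mono) auto
    finally have "1 - p\<^sub>f - \<eta> < p\<^sub>f + \<eta> + ?PX {s. \<not> clean V B (transcript s)}"
      using acc elim by linarith
    then show ?case
      by (simp add: \<eta>_def field_simps)
  qed
qed

text \<open>Indices beyond the end of a list yield junk edges, which only enlarges the set of probed edges.\<close>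

fun probe :: "adj_lists \<Rightarrow> query \<Rightarrow> (nat \<times> nat) option" where
  "probe X (DEG_IN u) = None"
| "probe X (DEG_OUT u) = None"
| "probe X (IN u i) = Some (in_list X u ! i, u)"
| "probe X (OUT u i) = Some (u, out_list X u ! i)"
| "probe X (ADJ u v) = Some (u, v)"

text \<open>By the assumption, uncleanness for an edge can only come from a query probing it, and
  each entry of the transcript probes at most one edge.\<close>

lemma card_probed_le:
  assumes "clean V {} h"
  shows "card {e. \<not> clean V {q. probe X q = Some e} h} \<le> length h"
    and "finite {e. \<not> clean V {q. probe X q = Some e} h}"
proof -
  define f where "f x = (case x of Asked q a \<Rightarrow> the (probe X q) | Computed r \<Rightarrow> undefined)" for x
  have sub: "{e. \<not> clean V {q. probe X q = Some e} h} \<subseteq> f ` set h"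
  proof
    fix e assume "e \<in> {e. \<not> clean V {q. probe X q = Some e} h}"
    then obtain q a where "Asked q a \<in> set h" "probe X q = Some e"
      using assms by (auto simp: clean_def)
    then show "e \<in> f ` set h"
      by (intro image_eqI[where x = "Asked q a"]) (auto simp: f_def)
  qed
  then show "finite {e. \<not> clean V {q. probe X q = Some e} h}"
    by (rule finite_subset) simp
  have "card {e. \<not> clean V {q. probe X q = Some e} h} \<le> card (f ` set h)"
    using sub by (intro card_mono) auto
  also have "\<dots> \<le> length h"
    using card_image_le[of "set h" f] card_length[of h] by simp
  finally show "card {e. \<not> clean V {q. probe X q = Some e} h} \<le> length h" .
qed

text \<open>By linearity, the sum is the expected number of edges of \<open>E\<close> probed within
  \<open>k\<close> steps, and each of them costs its own transcript entry.\<close>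

lemma sum_prob_probed_le_expected_time:
  assumes t: "t \<in> V" and "finite E"
    and closed: "\<And>q v. query_nodes q \<subseteq> V \<Longrightarrow> oracle_answer X q = Neighbor v \<Longrightarrow> v \<in> V"
  shows "ennreal (\<Sum>e\<in>E. measure_pmf.prob (run A X t k) {s. \<not> clean V {q. probe X q = Some e} (transcript s)})
    \<le> expected_time A X t"
proof -
  let ?N = "\<lambda>e. {s. \<not> clean V {q. probe X q = Some e} (transcript s)}"
  have "ennreal (\<Sum>e\<in>E. measure_pmf.prob (run A X t k) (?N e)) =
      (\<Sum>e\<in>E. emeasure (measure_pmf (run A X t k)) (?N e))"
    by (simp add: measure_pmf.emeasure_eq_measure)
  also have "\<dots> = (\<integral>\<^sup>+ s. (\<Sum>e\<in>E. indicator (?N e) s) \<partial>measure_pmf (run A X t k))"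
    by (subst nn_integral_sum) auto
  also have "\<dots> \<le> (\<integral>\<^sup>+ s. of_nat (length (transcript s)) \<partial>measure_pmf (run A X t k))"
  proof (rule nn_integral_mono_AE, unfold AE_measure_pmf_iff, rule ballI)
    fix s assume "s \<in> set_pmf (run A X t k)"
    then have c: "clean V {} (transcript s)"
      using neighbors_in_run[OF t] closed by blast
    have "(\<Sum>e\<in>E. indicator (?N e) s :: ennreal) = of_nat (card {e\<in>E. s \<in> ?N e})"
      using \<open>finite E\<close> by (simp add: indicator_def sum.If_cases Int_def)
    also have "card {e\<in>E. s \<in> ?N e} \<le> length (transcript s)"
      using card_mono[OF card_probed_le(2)[OF c]] card_probed_le(1)[OF c]
      by (rule order_trans) auto
    finally show "(\<Sum>e\<in>E. indicator (?N e) s :: ennreal) \<le> of_nat (length (transcript s))"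
      by simp
  qed
  also have "\<dots> \<le> expected_time A X t"
    unfolding expected_time_def by (rule SUP_upper) simp
  finally show ?thesis .
qed


section \<open>The hard instance\<close>

lemma Id_on_eq_image: "Id_on A = (\<lambda>v. (v, v)) ` A"
  by auto

lemma finite_Id_on: "finite A \<Longrightarrow> finite (Id_on A)"
  unfolding Id_on_eq_image by (rule finite_imageI)

lemma card_Id_on: "card (Id_on A) = card A"
  unfolding Id_on_eq_image by (rule card_image) (simp add: inj_on_def)

locale hard_instance =
  fixes U W T S :: "nat set" and x :: nat
  assumes finite: "finite U" "finite W" "finite T" "finite S"
    and nonempty: "W \<noteq> {}" "T \<noteq> {}"
    and disjoint: "U \<inter> W = {}" "U \<inter> T = {}" "U \<inter> S = {}" "W \<inter> T = {}" "W \<inter> S = {}" "T \<inter> S = {}"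
      "x \<notin> U" "x \<notin> W" "x \<notin> T" "x \<notin> S"
begin

text \<open>This set is closed under in- and out-neighbours in \<open>base\<close>, so a run from a
  target in \<open>T\<close> never learns of \<open>S\<close> or \<open>x\<close>.\<close>

definition visible :: "nat set" where
  "visible = U \<union> W \<union> T"

definition base :: "nat pair_pre_digraph" where
  "base = \<lparr>pverts = visible \<union> insert x S, parcs = U \<times> W \<union> W \<times> T \<union> Id_on (T \<union> insert x S)\<rparr>"

text \<open>Without self-loops on \<open>S\<close> and \<open>x\<close>, every walk from
  \<open>S\<close> that survives two steps is at \<open>w\<close>.\<close>

definition planted :: "nat \<Rightarrow> nat \<Rightarrow> nat pair_pre_digraph" where
  "planted u w = \<lparr>pverts = visible \<union> insert x S,
     parcs = (U \<times> W - {(u, w)}) \<union> W \<times> T \<union> Id_on T \<union> {(u, x), (x, w)} \<union> S \<times> {x}\<rparr>"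

lemma pagerank_graph_base: "pagerank_graph base"
proof -
  have "pair_fin_digraph base"
    by unfold_locales (auto simp: base_def visible_def finite finite_Id_on)
  moreover have "parcs base `` {v} \<noteq> {}" if "v \<in> pverts base" for v
    using that nonempty by (auto simp: base_def visible_def)
  ultimately show ?thesis
    by (simp add: pagerank_graph_def)
qed

lemma pagerank_graph_planted:
  assumes "u \<in> U" "w \<in> W"
  shows "pagerank_graph (planted u w)"
proof -
  have "pair_fin_digraph (planted u w)"
    using assms by unfold_locales (auto simp: planted_def visible_def finite finite_Id_on)
  moreover have "parcs (planted u w) `` {v} \<noteq> {}" if v: "v \<in> pverts (planted u w)" for v
  proof -
    obtain t where t: "t \<in> T"
      using nonempty by blast
    consider "v = u" | "v \<in> U" "v \<noteq> u" | "v \<in> W" | "v \<in> T" | "v \<in> S" | "v = x"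
      using v by (auto simp: planted_def visible_def)
    then have "\<exists>z. (v, z) \<in> parcs (planted u w)"
      by cases (use t assms in \<open>auto simp: planted_def\<close>)
    then show ?thesis
      by blast
  qed
  ultimately show ?thesis
    by (simp add: pagerank_graph_def)
qed

section \<open>The PageRank gap between \<open>base\<close> and \<open>planted\<close>\<close>

text \<open>The bound is the probability that a walk without termination ever visits
  \<open>t\<close>: from \<open>U\<close> or \<open>W\<close> it enters \<open>T\<close> at a
  uniformly random node and stays there. This function is superharmonic, as termination only shrinks
  the average over out-neighbours.\<close>

lemma ppr_base_le:
  assumes \<alpha>: "0 \<le> \<alpha>" "\<alpha> \<le> 1" and t: "t \<in> T" and s: "s \<in> pverts base"
  shows "ppr \<alpha> base s t \<le> of_bool (s = t) + of_bool (s \<in> U \<union> W) / real (card T)"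
proof (rule ppr_le_superharmonic[OF pagerank_graph_base s \<alpha>])
  let ?f = "\<lambda>v. of_bool (v = t) + of_bool (v \<in> U \<union> W) / real (card T)"
  have T: "card T > 0"
    using finite nonempty by (simp add: card_gt_0_iff)
  fix v assume v: "v \<in> pverts base"
  consider "v \<in> U" | "v \<in> W" | "v \<in> T" | "v \<in> insert x S"
    using v by (auto simp: base_def visible_def)
  then show "\<alpha> * of_bool (v = t) + (1 - \<alpha>) *
      ((\<Sum>z\<in>parcs base `` {v}. ?f z) / real (card (parcs base `` {v}))) \<le> ?f v"
  proof cases
    case 1
    have W: "card W > 0"
      using finite nonempty by (simp add: card_gt_0_iff)
    have out: "parcs base `` {v} = W"
      using 1 disjoint by (auto simp: base_def)
    have "(\<Sum>z\<in>W. ?f z) = (\<Sum>z\<in>W. 1 / real (card T))"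
      using t disjoint by (intro sum.cong) auto
    then have "(\<Sum>z\<in>W. ?f z) / real (card W) = 1 / real (card T)"
      using W by simp
    then show ?thesis
      unfolding out using 1 t disjoint \<alpha> T by (auto simp: field_simps)
  next
    case 2
    have out: "parcs base `` {v} = T"
      using 2 disjoint by (auto simp: base_def)
    have "(\<Sum>z\<in>T. ?f z) = (\<Sum>z\<in>T. if z = t then 1 else 0)"
      using t disjoint by (intro sum.cong) auto
    then have "(\<Sum>z\<in>T. ?f z) / real (card T) = 1 / real (card T)"
      using T t finite by simp
    then show ?thesis
      unfolding out using 2 t disjoint \<alpha> T by (auto simp: field_simps)
  next
    case 3
    have out: "parcs base `` {v} = {v}"
      using 3 disjoint by (auto simp: base_def)
    show ?thesis
      unfolding out using 3 t disjoint \<alpha> by auto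
  next
    case 4
    have out: "parcs base `` {v} = {v}"
      using 4 disjoint by (auto simp: base_def)
    show ?thesis
      unfolding out using 4 t disjoint \<alpha> by auto
  qed
qed simp

text \<open>The reservoir contributes nothing in \<open>base\<close>, so the numerator is
  independent of \<open>card S\<close>. In \<open>planted\<close> it grows linearly in
  \<open>card S\<close>, so a large \<open>S\<close> opens the gap.\<close>

lemma pagerank_base_le:
  assumes "0 \<le> \<alpha>" "\<alpha> \<le> 1" and t: "t \<in> T"
  shows "pagerank \<alpha> base t \<le> (1 + real (card U + card W) / real (card T)) / real (card (pverts base))"
proof -
  have fin: "finite (pverts base)"
    by (simp add: base_def visible_def finite)
  have "(\<Sum>s\<in>pverts base. ppr \<alpha> base s t)
      \<le> (\<Sum>s\<in>pverts base. of_bool (s = t) + of_bool (s \<in> U \<union> W) / real (card T))"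
    using ppr_base_le[OF assms] by (intro sum_mono)
  also have "\<dots> = (\<Sum>s\<in>pverts base. of_bool (s = t)) + (\<Sum>s\<in>pverts base. of_bool (s \<in> U \<union> W)) / real (card T)"
    by (simp add: sum.distrib sum_divide_distrib)
  also have "(\<Sum>s\<in>pverts base. of_bool (s = t)) = (1::real)"
    using t fin by (simp add: of_bool_def base_def visible_def)
  also have "(\<Sum>s\<in>pverts base. of_bool (s \<in> U \<union> W)) = real (card (U \<union> W))"
  proof -
    have "pverts base \<inter> (U \<union> W) = U \<union> W"
      by (auto simp: base_def visible_def)
    then show ?thesis
      using sum.inter_restrict[OF fin, of "\<lambda>_. 1::real" "U \<union> W"] by (simp add: of_bool_def)
  qed
  also have "card (U \<union> W) = card U + card W"
    using finite disjoint by (simp add: card_Un_disjoint)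
  finally show ?thesis
    unfolding pagerank_def by (simp add: divide_right_mono)
qed

text \<open>Follow the single path from \<open>s\<close> via \<open>x\<close> and \<open>w\<close>
  to \<open>t\<close> and stop there. The first two moves are forced unless the walk stops; the
  third hits \<open>t\<close> with chance 1 / \<open>card T\<close>.\<close>

lemma ppr_planted_ge:
  assumes \<alpha>: "0 \<le> \<alpha>" "\<alpha> \<le> 1" and uw: "u \<in> U" "w \<in> W" and t: "t \<in> T" and s: "s \<in> S"
  shows "(1 - \<alpha>) ^ 3 * \<alpha> / real (card T) \<le> ppr \<alpha> (planted u w) s t"
proof -
  let ?G = "planted u w"
  have out: "parcs ?G `` {s} = {x}" "parcs ?G `` {x} = {w}" "parcs ?G `` {w} = T"
    using assms disjoint by (auto simp: planted_def)
  have "1 \<le> pmf (walk \<alpha> ?G s 0) (At s)"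
    by simp
  moreover have "1 - \<alpha> \<le> pmf (walk_step \<alpha> ?G (At s)) (At x)"
    using pmf_walk_step_At[of \<alpha> ?G s x] \<alpha> out by auto
  ultimately have "1 * (1 - \<alpha>) \<le> pmf (walk \<alpha> ?G s (Suc 0)) (At x)"
    by (rule pmf_walk_Suc_ge) (use \<alpha> in auto)
  moreover have "1 - \<alpha> \<le> pmf (walk_step \<alpha> ?G (At x)) (At w)"
    using pmf_walk_step_At[of \<alpha> ?G x w] \<alpha> out by auto
  ultimately have "1 * (1 - \<alpha>) * (1 - \<alpha>) \<le> pmf (walk \<alpha> ?G s (Suc (Suc 0))) (At w)"
    by (rule pmf_walk_Suc_ge) (use \<alpha> in auto)
  moreover have "(1 - \<alpha>) / real (card T) \<le> pmf (walk_step \<alpha> ?G (At w)) (At t)"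
    using pmf_walk_step_At[of \<alpha> ?G w t] \<alpha> out t finite by auto
  ultimately have "1 * (1 - \<alpha>) * (1 - \<alpha>) * ((1 - \<alpha>) / real (card T)) \<le> pmf (walk \<alpha> ?G s (Suc (Suc (Suc 0)))) (At t)"
    by (rule pmf_walk_Suc_ge) (use \<alpha> in auto)
  moreover have "\<alpha> \<le> pmf (walk_step \<alpha> ?G (At t)) (Terminated t)"
    using pmf_walk_step_Terminated \<alpha> by auto
  ultimately have "1 * (1 - \<alpha>) * (1 - \<alpha>) * ((1 - \<alpha>) / real (card T)) * \<alpha>
      \<le> pmf (walk \<alpha> ?G s (Suc (Suc (Suc (Suc 0))))) (Terminated t)"
    by (rule pmf_walk_Suc_ge) (use \<alpha> in auto)
  also have "\<dots> \<le> ppr \<alpha> ?G s t"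
    by (rule pmf_le_ppr)
  finally show ?thesis
    by (simp add: power3_eq_cube)
qed

lemma pagerank_planted_ge:
  assumes "0 \<le> \<alpha>" "\<alpha> \<le> 1" "u \<in> U" "w \<in> W" "t \<in> T"
  shows "real (card S) * ((1 - \<alpha>) ^ 3 * \<alpha> / real (card T)) / real (card (pverts (planted u w)))
    \<le> pagerank \<alpha> (planted u w) t"
proof -
  have "real (card S) * ((1 - \<alpha>) ^ 3 * \<alpha> / real (card T)) \<le> (\<Sum>s\<in>S. ppr \<alpha> (planted u w) s t)"
    using ppr_planted_ge[OF assms] by (intro sum_bounded_below)
  also have "\<dots> \<le> (\<Sum>s\<in>pverts (planted u w). ppr \<alpha> (planted u w) s t)"
    by (intro sum_mono2) (auto simp: planted_def visible_def finite ppr_nonneg)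
  finally show ?thesis
    unfolding pagerank_def by (rule divide_right_mono) simp
qed

section \<open>Adjacency lists of the planted inputs, and the time bound per target\<close>

text \<open>At \<open>u\<close> and \<open>w\<close> one entry is replaced in place, so that all
  list lengths and all other positions seen by the algorithm stay the same, for any ordering used in
  \<open>X\<close>.\<close>

definition planted_input :: "adj_lists \<Rightarrow> nat \<Rightarrow> nat \<Rightarrow> adj_lists" where
  "planted_input X u w = \<lparr>graph_of = planted u w,
     out_list = (\<lambda>v. if v = u then map (\<lambda>z. if z = w then x else z) (out_list X u)
       else if v \<in> visible then out_list X v else if v = x then [w] else [x]),
     in_list = (\<lambda>v. if v = w then map (\<lambda>z. if z = u then x else z) (in_list X w)
       else if v \<in> visible then in_list X v else if v = x then sorted_list_of_set (insert u S) else [])\<rparr>"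

context
  fixes X :: adj_lists
  assumes valid: "valid_input X" and graph: "graph_of X = base"
begin

lemma lists_base:
  assumes "v \<in> visible"
  shows "distinct (out_list X v)" "set (out_list X v) = {z. (v, z) \<in> parcs base}"
    and "distinct (in_list X v)" "set (in_list X v) = {z. (z, v) \<in> parcs base}"
proof -
  have "v \<in> pverts (graph_of X)"
    using assms graph by (simp add: base_def)
  then show "distinct (out_list X v)" "set (out_list X v) = {z. (v, z) \<in> parcs base}"
    and "distinct (in_list X v)" "set (in_list X v) = {z. (z, v) \<in> parcs base}"
    using valid unfolding valid_input_def graph by blast+
qed

lemma set_out_list_base:
  assumes "v \<in> visible"
  shows "set (out_list X v) = (if v \<in> U then W else if v \<in> W then T else {v})"
proof -
  consider "v \<in> U" "v \<notin> W" "v \<notin> T" "v \<notin> S" "v \<noteq> x" | "v \<in> W" "v \<notin> U" "v \<notin> T" "v \<notin> S" "v \<noteq> x"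
    | "v \<in> T" "v \<notin> U" "v \<notin> W"
    using assms disjoint unfolding visible_def by blast
  then show ?thesis
    unfolding lists_base(2)[OF assms] by cases (auto simp: base_def)
qed

lemma set_in_list_base:
  assumes "v \<in> visible"
  shows "set (in_list X v) = (if v \<in> U then {} else if v \<in> W then U else insert v W)"
proof -
  consider "v \<in> U" "v \<notin> W" "v \<notin> T" "v \<notin> S" "v \<noteq> x" | "v \<in> W" "v \<notin> U" "v \<notin> T" "v \<notin> S" "v \<noteq> x"
    | "v \<in> T" "v \<notin> U" "v \<notin> W"
    using assms disjoint unfolding visible_def by blast
  then show ?thesis
    unfolding lists_base(4)[OF assms] by cases (auto simp: base_def)
qed

text \<open>The modified lists stay distinct because \<open>x\<close> occurs in no list of a visible
  node.\<close>

lemma valid_planted_input: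
  assumes u: "u \<in> U" and w: "w \<in> W"
  shows "valid_input (planted_input X u w)"
proof -
  let ?Y = "planted_input X u w" and ?G = "planted u w"
  have vis: "U \<subseteq> visible" "W \<subseteq> visible" "T \<subseteq> visible" "S \<inter> visible = {}" "x \<notin> visible"
    using disjoint by (auto simp: visible_def)
  have ne: "u \<noteq> w" "u \<noteq> x" "w \<noteq> x" "u \<notin> S" "w \<notin> S" "u \<notin> W" "w \<notin> U" "u \<notin> T" "w \<notin> T"
    using u w disjoint by auto
  have out: "distinct (out_list ?Y v) \<and> set (out_list ?Y v) = {z. (v, z) \<in> parcs ?G}"
    and "in": "distinct (in_list ?Y v) \<and> set (in_list ?Y v) = {z. (z, v) \<in> parcs ?G}"
    if v_in: "v \<in> pverts ?G" for v
  proof -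
    consider (U) "v \<in> U" | (W) "v \<in> W" | (T) "v \<in> T" | (S) "v \<in> S" | (x) "v = x"
      using v_in by (auto simp: planted_def visible_def)
    then have "(distinct (out_list ?Y v) \<and> set (out_list ?Y v) = {z. (v, z) \<in> parcs ?G}) \<and>
      (distinct (in_list ?Y v) \<and> set (in_list ?Y v) = {z. (z, v) \<in> parcs ?G})"
    proof cases
      case U
      then have v: "v \<in> visible" "v \<notin> W" "v \<notin> T" "v \<notin> S" "v \<noteq> x" "v \<noteq> w"
        using vis disjoint w by auto
      have "{z. (v, z) \<in> parcs ?G} = (if v = u then insert x (W - {w}) else W)" "{z. (z, v) \<in> parcs ?G} = {}"
        using U u v ne by (auto simp: planted_def)
      moreover have "distinct (out_list X v)" "set (out_list X v) = W" "in_list X v = []"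
        using U v lists_base(1,3)[of v] set_out_list_base[of v] set_in_list_base[of v] by auto
      ultimately show ?thesis
        using v w disjoint by (auto simp: planted_input_def distinct_map inj_on_def)
    next
      case W
      then have v: "v \<in> visible" "v \<notin> U" "v \<notin> T" "v \<notin> S" "v \<noteq> x" "v \<noteq> u"
        using vis disjoint u by auto
      have "{z. (v, z) \<in> parcs ?G} = T" "{z. (z, v) \<in> parcs ?G} = (if v = w then insert x (U - {u}) else U)"
        using W w v ne by (auto simp: planted_def)
      moreover have "distinct (out_list X v)" "set (out_list X v) = T" "distinct (in_list X v)" "set (in_list X v) = U"
        using W v lists_base(1,3)[of v] set_out_list_base[of v] set_in_list_base[of v] by auto
      ultimately show ?thesis
        using v u disjoint by (auto simp: planted_input_def distinct_map inj_on_def)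
    next
      case T
      then have v: "v \<in> visible" "v \<notin> U" "v \<notin> W" "v \<notin> S" "v \<noteq> x" "v \<noteq> u" "v \<noteq> w"
        using vis disjoint u w by auto
      have "{z. (v, z) \<in> parcs ?G} = {v}" "{z. (z, v) \<in> parcs ?G} = insert v W"
        using T v by (auto simp: planted_def)
      then show ?thesis
        using v lists_base(1,3)[of v] set_out_list_base[of v] set_in_list_base[of v] by (simp add: planted_input_def)
    next
      case S
      then have v: "v \<notin> visible" "v \<notin> U" "v \<notin> W" "v \<notin> T" "v \<noteq> x" "v \<noteq> u" "v \<noteq> w"
        using vis disjoint u w by auto
      have "{z. (v, z) \<in> parcs ?G} = {x}" "{z. (z, v) \<in> parcs ?G} = {}"
        using S v by (auto simp: planted_def)
      then show ?thesis
        using v by (simp add: planted_input_def)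
    next
      case x
      have "{z. (x, z) \<in> parcs ?G} = {w}" "{z. (z, x) \<in> parcs ?G} = insert u S"
        using disjoint ne by (auto simp: planted_def)
      then show ?thesis
        using x vis ne finite
        by (simp add: planted_input_def distinct_insort set_insort_key del: sorted_list_of_set_insert_remove)
    qed
    then show "distinct (out_list ?Y v) \<and> set (out_list ?Y v) = {z. (v, z) \<in> parcs ?G}"
      and "distinct (in_list ?Y v) \<and> set (in_list ?Y v) = {z. (z, v) \<in> parcs ?G}"
      by blast+
  qed
  have graph_Y: "graph_of ?Y = ?G"
    by (simp add: planted_input_def)
  show ?thesis
    unfolding valid_input_def graph_Y using pagerank_graph_planted[OF assms] out "in" by blast
qed

lemma oracle_answer_visible:
  assumes "query_nodes q \<subseteq> visible" "oracle_answer X q = Neighbor v"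
  shows "v \<in> visible"
proof (cases q)
  case (IN z i)
  then have "v \<in> set (in_list X z)" "z \<in> visible"
    using assms by (auto split: if_splits)
  then show ?thesis
    using set_in_list_base[of z] by (auto simp: visible_def split: if_splits)
next
  case (OUT z i)
  then have "v \<in> set (out_list X z)" "z \<in> visible"
    using assms by (auto split: if_splits)
  then show ?thesis
    using set_out_list_base[of z] by (auto simp: visible_def split: if_splits)
qed (use assms in auto)

text \<open>Degrees agree because \<open>map\<close> keeps lengths. An IN or OUT query sees a
  difference only at the replaced entry, whose probe is \<open>(u, w)\<close>, and this is also the
  only pair of visible nodes whose adjacency changes.\<close>

lemma oracle_answer_planted_input:
  assumes "u \<in> U" "w \<in> W" "query_nodes q \<subseteq> visible" "probe X q \<noteq> Some (u, w)"
  shows "oracle_answer X q = oracle_answer (planted_input X u w) q"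
  using assms
proof (cases q)
  case (ADJ a b)
  then have "a \<noteq> x" "b \<noteq> x" "a \<notin> S" "b \<notin> S" "(a, b) \<noteq> (u, w)"
    using assms disjoint by (auto simp: visible_def)
  then show ?thesis
    using ADJ graph by (auto simp: planted_input_def planted_def base_def)
qed (auto simp: planted_input_def)

text \<open>The run on \<open>X\<close> is compared with a separate planted input for each edge of
  \<open>U \<times> W\<close>, so each edge must be probed with constant probability. The time is
  measured on \<open>X\<close> alone.\<close>

lemma expected_time_ge:
  assumes \<alpha>: "0 \<le> \<alpha>" "\<alpha> \<le> 1" and \<epsilon>: "0 \<le> \<epsilon>" "\<epsilon> \<le> 1" and pf: "p\<^sub>f < 1 / 2"
    and A: "solves_single_node \<alpha> \<epsilon> p\<^sub>f A" and t: "t \<in> T"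
    and gap: "(1 + \<epsilon>) * (1 + real (card U + card W) / real (card T))
      \<le> (1 - \<epsilon>) * (real (card S) * ((1 - \<alpha>) ^ 3 * \<alpha> / real (card T)))"
  shows "ennreal ((1 - 2 * p\<^sub>f) / 2 * real (card U * card W)) \<le> expected_time A X t"
proof -
  let ?P = "\<lambda>k e. measure_pmf.prob (run A X t k) {s. \<not> clean visible {q. probe X q = Some e} (transcript s)}"
  have tv: "t \<in> visible"
    using t by (simp add: visible_def)
  have verts: "pverts (planted u w) = pverts base" for u w
    by (simp add: planted_def base_def)
  have "\<forall>\<^sub>F k in sequentially. (1 - 2 * p\<^sub>f) / 2 \<le> ?P k (u, w)" if uw: "u \<in> U" "w \<in> W" for u w
  proof (rule eventually_prob_distinguish[OF tv, where Y = "planted_input X u w"])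
    show "card (pverts (graph_of X)) = card (pverts (graph_of (planted_input X u w)))"
      using graph verts by (simp add: planted_input_def)
    show "oracle_answer X q = oracle_answer (planted_input X u w) q"
      if "query_nodes q \<subseteq> visible" "q \<notin> {q. probe X q = Some (u, w)}" for q
      using oracle_answer_planted_input[OF uw] that by simp
    show "failure_prob \<alpha> \<epsilon> A X t \<le> p\<^sub>f"
      using A valid graph tv by (simp add: solves_single_node_def base_def)
    show "failure_prob \<alpha> \<epsilon> A (planted_input X u w) t \<le> p\<^sub>f"
      using A valid_planted_input[OF uw] tv by (simp add: solves_single_node_def planted_input_def planted_def)
    \<comment> \<open>Both graphs have the same nodes, so the inequality \<open>gap\<close> between
      numerators carries over to PageRanks.\<close>
    let ?n = "real (card (pverts base))"
    have "(1 + \<epsilon>) * pagerank \<alpha> base t \<le> (1 + \<epsilon>) * ((1 + real (card U + card W) / real (card T)) / ?n)"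
      using pagerank_base_le[OF \<alpha> t] \<epsilon> by (intro mult_left_mono) auto
    also have "\<dots> \<le> (1 - \<epsilon>) * (real (card S) * ((1 - \<alpha>) ^ 3 * \<alpha> / real (card T)) / ?n)"
      using divide_right_mono[OF gap, of ?n] by simp
    also have "\<dots> \<le> (1 - \<epsilon>) * pagerank \<alpha> (planted u w) t"
      using pagerank_planted_ge[OF \<alpha> uw t] \<epsilon> unfolding verts by (intro mult_left_mono) auto
    finally show "(1 + \<epsilon>) * pagerank \<alpha> (graph_of X) t
        \<le> (1 - \<epsilon>) * pagerank \<alpha> (graph_of (planted_input X u w)) t"
      by (simp add: graph planted_input_def)
  qed (rule pf)
  \<comment> \<open>Finitely many edges allow one time \<open>k\<close> that serves all of
    them.\<close>
  then have "\<forall>\<^sub>F k in sequentially. \<forall>e\<in>U \<times> W. (1 - 2 * p\<^sub>f) / 2 \<le> ?P k e"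
    using finite by (intro eventually_ball_finite) auto
  then obtain k where k: "\<forall>e\<in>U \<times> W. (1 - 2 * p\<^sub>f) / 2 \<le> ?P k e"
    using eventually_happens'[OF sequentially_bot] by blast
  have "(1 - 2 * p\<^sub>f) / 2 * real (card U * card W) \<le> (\<Sum>e\<in>U \<times> W. ?P k e)"
    using sum_bounded_below[of "U \<times> W" "(1 - 2 * p\<^sub>f) / 2" "?P k", OF bspec[OF k]]
    by (simp add: card_cartesian_product mult.commute)
  then have "ennreal ((1 - 2 * p\<^sub>f) / 2 * real (card U * card W)) \<le> ennreal (\<Sum>e\<in>U \<times> W. ?P k e)"
    by (rule ennreal_leI)
  also have "\<dots> \<le> expected_time A X t"
    using finite oracle_answer_visible by (intro sum_prob_probed_le_expected_time tv) auto
  finally show ?thesis .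
qed

end

section \<open>Sizes and choice of the parameters\<close>

lemma card_pverts_base: "card (pverts base) = card U + card W + card T + card S + 1"
  using finite disjoint by (simp add: base_def visible_def card_Un_disjoint Int_Un_distrib2)

lemma card_parcs_base: "card (parcs base) = card U * card W + card W * card T + card T + card S + 1"
proof -
  have "card (Id_on (T \<union> insert x S)) = card T + card S + 1"
    using finite disjoint by (simp add: card_Id_on card_Un_disjoint del: Un_insert_right)
  moreover have "card (U \<times> W \<union> W \<times> T) = card U * card W + card W * card T"
    using finite disjoint by (subst card_Un_disjoint) (auto simp: card_cartesian_product)
  moreover have "(U \<times> W \<union> W \<times> T) \<inter> Id_on (T \<union> insert x S) = {}"
    using disjoint by auto
  moreover have "finite (Id_on (T \<union> insert x S))"
    using finite by (simp add: finite_Id_on)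
  ultimately show ?thesis
    using finite by (simp add: base_def card_Un_disjoint del: Un_insert_right)
qed

end

theorem theorem6p5:
  fixes \<alpha> \<epsilon> p\<^sub>f :: real
  assumes "0 < \<alpha>" "\<alpha> < 1"
    and "0 < \<epsilon>" "\<epsilon> < 1"
    and "0 < p\<^sub>f" "p\<^sub>f < 1 / 2"
  shows "\<exists>c>0. \<exists>C>0. \<exists>d>0. \<forall>n m :: nat. 1 \<le> n \<and> n \<le> m \<and> m \<le> n\<^sup>2 \<longrightarrow>
    (\<exists>G. pagerank_graph G \<and>
       c * real n \<le> real (card (pverts G)) \<and> real (card (pverts G)) \<le> C * real n \<and>
       c * real m \<le> real (card (parcs G)) \<and> real (card (parcs G)) \<le> C * real m \<and>
       (\<forall>X A. valid_input X \<and> graph_of X = G \<and> solves_single_node \<alpha> \<epsilon> p\<^sub>f A \<longrightarrow>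
          (\<Sum>t\<in>pverts G. expected_time A X t) / of_nat (card (pverts G)) \<ge> ennreal (d * real m) \<and>
          (\<exists>t\<in>pverts G. expected_time A X t \<ge> ennreal (d * real m))))"
proof -
  define b where "b = (1 - \<epsilon>) * ((1 - \<alpha>) ^ 3 * \<alpha>)"
  have b: "b > 0"
    using assms by (simp add: b_def)
  \<comment> \<open>With \<open>card S\<close> = \<open>N * n\<close>, the planted numerator scaled
    by 1 - \<open>\<epsilon>\<close> is at least \<open>b * real N\<close>. The 3 bounds the base
    numerator 1 + (n + k) / n.\<close>
  obtain N :: nat where N: "(1 + \<epsilon>) * 3 / b \<le> real N"
    using real_arch_simple by blast
  then have N': "(1 + \<epsilon>) * 3 \<le> b * real N"
    using b by (simp add: field_simps)
  define \<delta> where "\<delta> = (1 - 2 * p\<^sub>f) / 2"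
  have \<delta>: "\<delta> > 0"
    using assms by (simp add: \<delta>_def)
  define C where "C = real N + 4"
  have C: "C \<ge> 4"
    by (simp add: C_def)
  \<comment> \<open>The factor 2 pays for rounding \<open>m\<close> down to a multiple of
    \<open>n\<close>, and \<open>C\<close> for averaging over all nodes when only the targets in
    \<open>T\<close> are known to be expensive.\<close>
  define d where "d = \<delta> / (2 * C)"
  have d: "d > 0"
    using \<delta> C by (simp add: d_def)
  show ?thesis
  proof (rule exI[of _ "1 / 2"], rule conjI[rotated], rule exI[of _ C], rule conjI[rotated],
      rule exI[of _ d], rule conjI[rotated], intro allI impI)
    fix n m :: nat assume nm: "1 \<le> n \<and> n \<le> m \<and> m \<le> n\<^sup>2"
    \<comment> \<open>The bounds on \<open>m\<close> give 1 \<le> \<open>k\<close> \<le>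
      \<open>n\<close>, so \<open>W\<close> is nonempty and the number of nodes stays linear in
      \<open>n\<close>.\<close>
    define k where "k = m div n"
    have k1: "1 \<le> k"
      using nm by (simp add: k_def div_greater_zero_iff Suc_le_eq)
    have kn: "k \<le> n"
      using nm div_le_mono[of m "n * n" n] by (simp add: k_def power2_eq_square)
    have nk: "n * k \<le> m"
      by (simp add: k_def)
    have "m = n * k + m mod n" "m mod n < n"
      using nm by (simp_all add: k_def)
    moreover have "n \<le> n * k"
      using k1 by simp
    \<comment> \<open>The remainder is below \<open>n\<close> \<le> \<open>n * k\<close>, so
      rounding loses at most half of \<open>m\<close>.\<close>
    ultimately have mk: "m \<le> 2 * (n * k)"
      by linarith
    define U where "U = {0..<n}"
    define W where "W = {n..<n + k}"
    define T where "T = {n + k..<2 * n + k}"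
    define S where "S = {2 * n + k..<2 * n + k + N * n}"
    define x where "x = 2 * n + k + N * n"
    have cards: "card U = n" "card W = k" "card T = n" "card S = N * n"
      by (simp_all add: U_def W_def T_def S_def)
    interpret hard_instance U W T S x
      using nm k1 by unfold_locales (auto simp: U_def W_def T_def S_def x_def)
    have fin: "finite (pverts base)"
      by (simp add: base_def visible_def finite)
    have Tsub: "T \<subseteq> pverts base"
      by (auto simp: base_def visible_def)
    have verts: "card (pverts base) = 2 * n + k + N * n + 1"
      by (simp add: card_pverts_base cards)
    have vertsC: "real (card (pverts base)) \<le> C * real n"
    proof -
      have "card (pverts base) \<le> (N + 4) * n"
        using nm kn by (simp add: verts algebra_simps)
      then have "real (card (pverts base)) \<le> real ((N + 4) * n)"
        by (simp only: of_nat_le_iff)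
      then show ?thesis
        by (simp add: C_def)
    qed
    have arcsC: "real (card (parcs base)) \<le> C * real m"
    proof -
      have "card (parcs base) = 2 * (n * k) + n + N * n + 1"
        by (simp add: card_parcs_base cards)
      also have "\<dots> \<le> (N + 4) * m"
      proof -
        have "2 * (n * k) + n + N * n + 1 \<le> 2 * m + m + N * m + m"
          using nm nk by (intro add_mono mult_le_mono) auto
        then show ?thesis
          by (simp add: algebra_simps)
      qed
      finally have "real (card (parcs base)) \<le> real ((N + 4) * m)"
        by (simp only: of_nat_le_iff)
      then show ?thesis
        by (simp add: C_def)
    qed
    have arcs_ge: "1 / 2 * real m \<le> real (card (parcs base))"
    proof -
      have "m \<le> 2 * card (parcs base)"
        using mk by (rule order_trans) (simp add: card_parcs_base cards)
      then show ?thesis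
        by linarith
    qed
    have gap: "(1 + \<epsilon>) * (1 + real (card U + card W) / real (card T))
      \<le> (1 - \<epsilon>) * (real (card S) * ((1 - \<alpha>) ^ 3 * \<alpha> / real (card T)))"
    proof -
      have "real (n + k) / real n \<le> 2"
        using kn nm by (simp add: field_simps)
      then have "(1 + \<epsilon>) * (1 + real (n + k) / real n) \<le> (1 + \<epsilon>) * 3"
        using assms by (intro mult_left_mono) auto
      also have "\<dots> \<le> b * real N"
        by (rule N')
      also have "\<dots> = (1 - \<epsilon>) * (real (N * n) * ((1 - \<alpha>) ^ 3 * \<alpha> / real n))"
        using nm by (simp add: b_def)
      finally show ?thesis
        by (simp add: cards)
    qed
    have time: "ennreal (C * (d * real m)) \<le> expected_time A X t"
      if "valid_input X" "graph_of X = base" "solves_single_node \<alpha> \<epsilon> p\<^sub>f A" "t \<in> T" for X A t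
    proof -
      have "real m \<le> 2 * real (n * k)"
        using mk by linarith
      then have "\<delta> * real m \<le> \<delta> * (2 * real (n * k))"
        using \<delta> by (intro mult_left_mono) auto
      then have "C * (d * real m) \<le> \<delta> * real (card U * card W)"
        using C by (simp add: d_def cards)
      then have "ennreal (C * (d * real m)) \<le> ennreal (\<delta> * real (card U * card W))"
        by (rule ennreal_leI)
      also have "\<dots> \<le> expected_time A X t"
        unfolding \<delta>_def using assms that gap by (intro expected_time_ge) auto
      finally show ?thesis .
    qed
    have "(\<Sum>t\<in>pverts base. expected_time A X t) / of_nat (card (pverts base)) \<ge> ennreal (d * real m) \<and>
          (\<exists>t\<in>pverts base. expected_time A X t \<ge> ennreal (d * real m))"
      if XA: "valid_input X \<and> graph_of X = base \<and> solves_single_node \<alpha> \<epsilon> p\<^sub>f A" for X A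
    proof
      have time': "ennreal (C * (d * real m)) \<le> expected_time A X t" if "t \<in> T" for t
        using time XA that by blast
      let ?v = "real (card (pverts base))"
      have v: "?v > 0"
        unfolding verts of_nat_0_less_iff by simp
      \<comment> \<open>The \<open>n\<close> targets in \<open>T\<close> make up at least a 1 /
        \<open>C\<close> fraction of all nodes, which uses up the extra factor \<open>C\<close> in
        \<open>time'\<close>.\<close>
      have "d * real m * ?v \<le> d * real m * (C * real n)"
        using vertsC d by (intro mult_left_mono) auto
      then have "ennreal (d * real m * ?v) \<le> ennreal (real n * (C * (d * real m)))"
        by (intro ennreal_leI) (simp add: mult_ac)
      also have "\<dots> = (\<Sum>t\<in>T. ennreal (C * (d * real m)))"
        using C d by (simp add: cards ennreal_mult ennreal_of_nat_eq_real_of_nat)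
      also have "\<dots> \<le> (\<Sum>t\<in>T. expected_time A X t)"
        by (intro sum_mono time')
      also have "\<dots> \<le> (\<Sum>t\<in>pverts base. expected_time A X t)"
        using fin Tsub by (intro sum_mono2) auto
      finally have "ennreal (d * real m * ?v) / of_nat (card (pverts base))
          \<le> (\<Sum>t\<in>pverts base. expected_time A X t) / of_nat (card (pverts base))"
        by (rule divide_right_mono_ennreal)
      moreover have "ennreal (d * real m * ?v) / of_nat (card (pverts base)) = ennreal (d * real m)"
        using v d by (simp add: ennreal_of_nat_eq_real_of_nat divide_ennreal)
      ultimately show "(\<Sum>t\<in>pverts base. expected_time A X t) / of_nat (card (pverts base)) \<ge> ennreal (d * real m)"
        by simp
      obtain t where t: "t \<in> T"
        using nonempty by blast
      have "1 * (d * real m) \<le> C * (d * real m)"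
        using C d by (intro mult_right_mono) auto
      then have "ennreal (d * real m) \<le> ennreal (C * (d * real m))"
        by (intro ennreal_leI) simp
      also have "\<dots> \<le> expected_time A X t"
        by (rule time'[OF t])
      finally show "\<exists>t\<in>pverts base. expected_time A X t \<ge> ennreal (d * real m)"
        using t Tsub by blast
    qed
    then show "\<exists>G. pagerank_graph G \<and>
       1 / 2 * real n \<le> real (card (pverts G)) \<and> real (card (pverts G)) \<le> C * real n \<and>
       1 / 2 * real m \<le> real (card (parcs G)) \<and> real (card (parcs G)) \<le> C * real m \<and>
       (\<forall>X A. valid_input X \<and> graph_of X = G \<and> solves_single_node \<alpha> \<epsilon> p\<^sub>f A \<longrightarrow>
          (\<Sum>t\<in>pverts G. expected_time A X t) / of_nat (card (pverts G)) \<ge> ennreal (d * real m) \<and>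
          (\<exists>t\<in>pverts G. expected_time A X t \<ge> ennreal (d * real m)))"
      using pagerank_graph_base vertsC arcsC arcs_ge
      by (intro exI[of _ base] conjI) (auto simp: verts)
  qed (use C d in auto)
qed

end
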